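(* (Limit Wall case.) Let $0<|q|<1$, let $A\neq0$ be a complex number with $A\notin\{q^{-k}:k\ge0\}$, and let $$a_n=\frac{q^n}{A}-(1+q)q^{2n-1},\qquad b_n^2=-\frac{q^{3n-2}}{A}(1-Aq^{n-1}).$$ Then for $z\ne0$ for which the expressions on the right are defined, $$\cfrac{1}{z-a_0-\cfrac{b_1^2}{z-a_1-\cfrac{b_2^2}{z-a_2-\cdots}}}=\frac1z\,\frac{{}_0\phi_1\left(\begin{matrix}-\\ q/(Az)\end{matrix};\frac qz\right)}{\left(1-\frac1{Az}\right){}_0\phi_1\left(\begin{matrix}-\\ 1/(Az)\end{matrix};\frac1{qz}\right)}=\frac1z\,\frac{{}_1\phi_1\left(\begin{matrix}A\\0\end{matrix};\frac{q}{Az}\right)}{{}_1\phi_1\left(\begin{matrix}A/q\\0\end{matrix};\frac1{Az}\right)}.$$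
   Context: Notation: $(a)_k=\prod_{j=0}^{k-1}(1-aq^j)$, ${}_0\phi_1\left(\begin{matrix}-\\ c\end{matrix};w\right)=\sum_{k\ge0}\frac{q^{k(k-1)}}{(c)_k(q)_k}w^k$ and ${}_1\phi_1\left(\begin{matrix}a\\ c\end{matrix};w\right)=\sum_{k\ge0}\frac{(a)_k}{(c)_k(q)_k}(-1)^kq^{k(k-1)/2}w^k$. "Defined" means that no lower parameter is of the form $q^{-k}$ ($k\ge0$) and the denominators do not vanish. *)

theory Defs
  imports "HOL-Analysis.Analysis"
begin

definition qpoch :: "complex \<Rightarrow> complex \<Rightarrow> nat \<Rightarrow> complex" where
  "qpoch q a k = (\<Prod>j<k. 1 - a * q ^ j)"

definition phi01 :: "complex \<Rightarrow> complex \<Rightarrow> complex \<Rightarrow> complex" where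
  "phi01 q c w = (\<Sum>k. q ^ (k * (k - 1)) / (qpoch q c k * qpoch q q k) * w ^ k)"

definition phi11 :: "complex \<Rightarrow> complex \<Rightarrow> complex \<Rightarrow> complex \<Rightarrow> complex" where
  "phi11 q a c w =
     (\<Sum>k. qpoch q a k / (qpoch q c k * qpoch q q k) * (-1) ^ k * q ^ (k * (k - 1) div 2) * w ^ k)"

text \<open>Admissibility of a lower parameter: \<open>c\<close> is not of the form \<open>q\<^sup>-\<^sup>k\<close>.\<close>

definition lower_ok :: "complex \<Rightarrow> complex \<Rightarrow> bool" where
  "lower_ok q c \<longleftrightarrow> (\<forall>k::nat. c \<noteq> q powi (- int k))"

text \<open>
  Wallis numerators and denominators of \<open>c\<^sub>0 / (d\<^sub>0 + c\<^sub>1 / (d\<^sub>1 + c\<^sub>2 / (d\<^sub>2 + \<dots>)))\<close>; index \<open>n\<close> belongs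
  to the fraction truncated after \<open>n\<close> levels. They are used in place of nested division because
  an intermediate denominator of an approximant may vanish, and \<open>x / 0 = 0\<close> in HOL would
  then give a wrong value.
\<close>

fun cf_num :: "(nat \<Rightarrow> complex) \<Rightarrow> (nat \<Rightarrow> complex) \<Rightarrow> nat \<Rightarrow> complex" where
  "cf_num c d 0 = 0"
| "cf_num c d (Suc 0) = c 0"
| "cf_num c d (Suc (Suc n)) = d (Suc n) * cf_num c d (Suc n) + c (Suc n) * cf_num c d n"

fun cf_den :: "(nat \<Rightarrow> complex) \<Rightarrow> (nat \<Rightarrow> complex) \<Rightarrow> nat \<Rightarrow> complex" where
  "cf_den c d 0 = 1"
| "cf_den c d (Suc 0) = d 0"
| "cf_den c d (Suc (Suc n)) = d (Suc n) * cf_den c d (Suc n) + c (Suc n) * cf_den c d n"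

text \<open>Convergence of the continued fraction to a finite value.\<close>

definition cf_has_value :: "(nat \<Rightarrow> complex) \<Rightarrow> (nat \<Rightarrow> complex) \<Rightarrow> complex \<Rightarrow> bool" where
  "cf_has_value c d L \<longleftrightarrow>
     (\<forall>\<^sub>F n in sequentially. cf_den c d n \<noteq> 0) \<and>
     (\<lambda>n. cf_num c d n / cf_den c d n) \<longlonglongrightarrow> L"

text \<open>
  Where no intermediate denominator vanishes, the quotients above are the truncated nested
  fractions.
\<close>

fun cf_nested :: "(nat \<Rightarrow> complex) \<Rightarrow> (nat \<Rightarrow> complex) \<Rightarrow> nat \<Rightarrow> complex" where
  "cf_nested c d 0 = 0"
| "cf_nested c d (Suc n) = c 0 / (d 0 + cf_nested (\<lambda>i. c (Suc i)) (\<lambda>i. d (Suc i)) n)"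

fun cf_nested_ok :: "(nat \<Rightarrow> complex) \<Rightarrow> (nat \<Rightarrow> complex) \<Rightarrow> nat \<Rightarrow> bool" where
  "cf_nested_ok c d 0 = True"
| "cf_nested_ok c d (Suc n) =
     (d 0 + cf_nested (\<lambda>i. c (Suc i)) (\<lambda>i. d (Suc i)) n \<noteq> 0 \<and>
      cf_nested_ok (\<lambda>i. c (Suc i)) (\<lambda>i. d (Suc i)) n)"

lemma cf_num_shift: "cf_num c d (Suc n) = c 0 * cf_den (\<lambda>i. c (Suc i)) (\<lambda>i. d (Suc i)) n"
  by (induction n rule: induct_nat_012) (simp_all add: algebra_simps)

lemma cf_den_shift:
  "cf_den c d (Suc n) = d 0 * cf_den (\<lambda>i. c (Suc i)) (\<lambda>i. d (Suc i)) n
     + cf_num (\<lambda>i. c (Suc i)) (\<lambda>i. d (Suc i)) n"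
  by (induction n rule: induct_nat_012) (simp_all add: algebra_simps)

lemma cf_nested_eq:
  assumes "cf_nested_ok c d n"
  shows "cf_den c d n \<noteq> 0 \<and> cf_nested c d n = cf_num c d n / cf_den c d n"
  using assms
proof (induction n arbitrary: c d)
  case (Suc n)
  let ?c = "\<lambda>i. c (Suc i)" and ?d = "\<lambda>i. d (Suc i)"
  have IH: "cf_den ?c ?d n \<noteq> 0" "cf_nested ?c ?d n = cf_num ?c ?d n / cf_den ?c ?d n"
    using Suc.IH[of ?c ?d] Suc.prems by auto
  have "cf_den c d (Suc n) = (d 0 + cf_nested ?c ?d n) * cf_den ?c ?d n"
    using IH by (simp add: cf_den_shift field_simps)
  then show ?case
    using IH(1) Suc.prems by (simp add: cf_num_shift)
qed simp

text \<open>The coefficient sequence \<open>b\<^sub>n\<^sup>2\<close> is meaningful for \<open>n \<ge> 1\<close>; \<open>n = 0\<close> is never used.\<close>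

definition wall_a :: "complex \<Rightarrow> complex \<Rightarrow> nat \<Rightarrow> complex" where
  "wall_a q A n = q ^ n / A - (1 + q) * q powi (2 * int n - 1)"

definition wall_bsq :: "complex \<Rightarrow> complex \<Rightarrow> nat \<Rightarrow> complex" where
  "wall_bsq q A n = - (q powi (3 * int n - 2) / A) * (1 - A * q powi (int n - 1))"

text \<open>\<open>1 / (z - a\<^sub>0 - b\<^sub>1\<^sup>2 / (z - a\<^sub>1 - b\<^sub>2\<^sup>2 / (z - a\<^sub>2 - \<dots>)))\<close> converges to \<open>L\<close>.\<close>

definition jfrac_has_value :: "(nat \<Rightarrow> complex) \<Rightarrow> (nat \<Rightarrow> complex) \<Rightarrow> complex \<Rightarrow> complex \<Rightarrow> bool" where
  "jfrac_has_value a bsq z L \<longleftrightarrow>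
     cf_has_value (\<lambda>n. if n = 0 then 1 else - bsq n) (\<lambda>n. z - a n) L"

end

(*
  Write the three-term recurrence X_n = (1 - a_n/z) X_{n+1} - (b_{n+1}^2/z^2) X_{n+2}. The denominators
  D_n of the continued fraction satisfy X_0 = (D_{n+1}/z^{n+1}) X_{n+1} - (b_{n+1}^2/z^2) (D_n/z^n) X_{n+2}
  for every solution X. As a_n and b_n^2 are O(|q|^n), D_n/z^n is bounded, so D_n/z^n * lim X tends to X_0
  whenever X converges; the same for the shifted coefficients shows that N_{n+1}/z^n * lim X tends to X_1.
  With v = 1/(Az), two convergent solutions are
    Q_n = 1phi1(A q^{n-1}; 0; v q^n), with limit 1, and
    U_n = 0phi1(-; v q^n; A v q^{2n-1}) / (v)_n, with limit 1/(v)_infinity.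
  Hence the value is Q_1/(z Q_0), and (D_n/z^n, N_{n+1}/z^n) having one limit forces U_1/U_0 = Q_1/Q_0,
  which is the second equality without any transformation formula.
*)
theory Submission
  imports Defs
begin

section \<open>Continued fraction denominators tested against a convergent solution of the
  recurrence\<close>

text \<open>A single summable majorant \<open>e\<close> controls both perturbations of the
  recurrence, so a discrete Gronwall estimate bounds \<open>cf_den c d n / z^n\<close>. The
  coefficients stay general so that the same result serves the shifted fraction.\<close>

lemma cf_den_tendsto:
  fixes c d X :: "nat \<Rightarrow> complex" and e :: "nat \<Rightarrow> real"
  assumes z: "z \<noteq> 0"
    and rec: "\<And>n. X n = d n / z * X (Suc n) + c (Suc n) / z^2 * X (Suc (Suc n))"
    and X: "X \<longlonglongrightarrow> x"
    and e: "summable e"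
    and d: "\<And>n. norm (d n / z - 1) \<le> e n"
    and c: "\<And>n. norm (c (Suc n) / z^2) \<le> e (Suc n)"
  shows "(\<lambda>n. cf_den c d n / z^n * x) \<longlonglongrightarrow> X 0"
proof -
  define p where "p = (\<lambda>n. cf_den c d n / z^n)"
  define b where "b = (\<lambda>n. c (Suc n) / z^2)"
  have p0: "p 0 = 1" and p1: "p (Suc 0) = d 0 / z"
    by (simp_all add: p_def)
  have pSS: "p (Suc (Suc n)) = d (Suc n) / z * p (Suc n) + b n * p n" for n
    using z by (simp add: p_def b_def field_simps power2_eq_square)
  have e0: "0 \<le> e n" for n
    using d[of n] norm_ge_zero order_trans by blast
  \<comment> \<open>Inserting the recurrence for \<open>X (Suc n)\<close> makes the coefficient of
    \<open>X (Suc (Suc n))\<close> equal to \<open>d (Suc n) / z * p (Suc n) + b n * p n\<close>,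
    which is \<open>p (Suc (Suc n))\<close>.\<close>
  have inv: "X 0 = p (Suc n) * X (Suc n) + b n * p n * X (Suc (Suc n))" for n
  proof (induction n)
    case 0
    show ?case using rec[of 0] by (simp add: p0 p1 b_def)
  next
    case (Suc n)
    show ?case
      unfolding Suc.IH pSS rec[of "Suc n"] by (simp add: b_def algebra_simps)
  qed
  \<comment> \<open>The factor 2 collects one \<open>e k\<close> from \<open>norm (d k / z)\<close>
    and one from the coefficient \<open>b\<close> in the same step; the majorant of \<open>c\<close>
    is indexed by \<open>Suc n\<close> so that these two agree.\<close>
  define M where "M = (\<lambda>n. \<Prod>k<n. 1 + 2 * e k)"
  have M1: "1 \<le> M n" for n
    unfolding M_def by (intro prod_ge_1) (use e0 in auto)
  have MS: "M (Suc n) = M n + 2 * e n * M n" for n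
    by (simp add: M_def algebra_simps)
  have Mmono: "M n \<le> M (Suc n)" for n
    using M1[of n] e0[of n] by (simp add: MS)
  have dn: "norm (d n / z) \<le> 1 + e n" for n
    using norm_triangle_ineq[of "d n / z - 1" 1] d[of n] by simp
  have pM: "norm (p n) \<le> M n \<and> norm (p (Suc n)) \<le> M (Suc n)" for n
  proof (induction n)
    case 0
    show ?case using dn[of 0] e0[of 0] by (simp add: p0 p1 M_def)
  next
    case (Suc n)
    have "norm (p (Suc (Suc n))) \<le> norm (d (Suc n) / z) * norm (p (Suc n)) + norm (b n) * norm (p n)"
      unfolding pSS by (metis norm_mult norm_triangle_ineq)
    also have "\<dots> \<le> (1 + e (Suc n)) * M (Suc n) + e (Suc n) * M (Suc n)"
      using Suc Mmono[of n] c[of n] e0[of "Suc n"]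
      by (intro add_mono mult_mono dn) (auto simp: b_def)
    also have "\<dots> = M (Suc (Suc n))"
      by (simp only: MS[of "Suc n"]) (simp add: algebra_simps)
    finally show ?case using Suc by simp
  qed
  have MB: "M n \<le> exp (2 * suminf e)" for n
  proof -
    have "M n \<le> exp (\<Sum>k<n. 2 * e k)"
      unfolding M_def by (intro prod_le_exp_sum) (use e0 in auto)
    also have "(\<Sum>k<n. 2 * e k) \<le> 2 * suminf e"
      using sum_le_suminf[OF e, of "{..<n}"] e0 by (simp add: sum_distrib_left[symmetric])
    finally show ?thesis by simp
  qed
  have pE: "norm (p n) \<le> exp (2 * suminf e)" for n
    using pM[of n] MB[of n] by linarith
  have bp: "(\<lambda>n. b n * p n) \<longlonglongrightarrow> 0"
  proof (rule Lim_null_comparison)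
    show "\<forall>\<^sub>F n in sequentially. norm (b n * p n) \<le> e (Suc n) * exp (2 * suminf e)"
      unfolding norm_mult b_def
      by (intro always_eventually allI mult_mono c pE e0) auto
    show "(\<lambda>n. e (Suc n) * exp (2 * suminf e)) \<longlonglongrightarrow> 0"
      using summable_LIMSEQ_zero[OF e] by (intro tendsto_mult_left_zero LIMSEQ_Suc)
  qed
  have X2: "(\<lambda>n. X (Suc (Suc n))) \<longlonglongrightarrow> x" and X1: "(\<lambda>n. X (Suc n)) \<longlonglongrightarrow> x"
    using X by (auto intro: LIMSEQ_Suc)
  have "(\<lambda>n. b n * p n * X (Suc (Suc n))) \<longlonglongrightarrow> 0"
    using tendsto_mult[OF bp X2] by simp
  \<comment> \<open>At this point \<open>p\<close> is known to be bounded, not convergent, so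
    replacing \<open>X (Suc n)\<close> by \<open>x\<close> is justified by a vanishing error term
    instead of a product of limits.\<close>
  moreover have "(\<lambda>n. p (Suc n) * (X (Suc n) - x)) \<longlonglongrightarrow> 0"
  proof (rule Lim_null_comparison)
    show "\<forall>\<^sub>F n in sequentially. norm (p (Suc n) * (X (Suc n) - x))
            \<le> exp (2 * suminf e) * norm (X (Suc n) - x)"
      by (intro always_eventually allI) (simp add: norm_mult mult_right_mono pE)
    have "(\<lambda>n. X (Suc n) - x) \<longlonglongrightarrow> 0"
      using X1 LIM_zero by blast
    then show "(\<lambda>n. exp (2 * suminf e) * norm (X (Suc n) - x)) \<longlonglongrightarrow> 0"
      using tendsto_mult_right_zero tendsto_norm_zero by blast
  qed
  ultimately have "(\<lambda>n. X 0 - b n * p n * X (Suc (Suc n)) - p (Suc n) * (X (Suc n) - x))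
      \<longlonglongrightarrow> X 0 - 0 - 0"
    by (intro tendsto_diff tendsto_const)
  moreover have "X 0 - b n * p n * X (Suc (Suc n)) - p (Suc n) * (X (Suc n) - x) = p (Suc n) * x" for n
    using inv[of n] by (simp add: algebra_simps)
  ultimately have "(\<lambda>n. p (Suc n) * x) \<longlonglongrightarrow> X 0"
    by simp
  then show ?thesis
    unfolding p_def by (rule LIMSEQ_imp_Suc)
qed

section \<open>Summation of series with quadratic powers of the base\<close>

lemma triangle_Suc: "Suc k * (Suc k - 1) div 2 = k * (k - 1) div 2 + k" for k :: nat
  by (induction k) auto

text \<open>Consecutive terms have ratio \<open>r ^ k * \<rho>\<close>, which tends to 0 however
  large \<open>\<rho>\<close> is.\<close>

lemma summable_power_triangle:
  fixes r \<rho> :: real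
  assumes "0 < r" "r < 1" "0 \<le> \<rho>"
  shows "summable (\<lambda>k. r ^ (k * (k - 1) div 2) * \<rho> ^ k)"
proof -
  have "(\<lambda>k. r ^ k * \<rho>) \<longlonglongrightarrow> 0"
    using assms by (intro tendsto_mult_left_zero LIMSEQ_realpow_zero) auto
  then have "\<forall>\<^sub>F k in sequentially. r ^ k * \<rho> < 1 / 2"
    by (rule order_tendstoD) simp
  then obtain N where N: "r ^ k * \<rho> < 1 / 2" if "k \<ge> N" for k
    by (auto simp: eventually_sequentially)
  show ?thesis
  proof (rule summable_ratio_test[of "1/2" N])
    fix k assume "N \<le> k"
    have "norm (r ^ (Suc k * (Suc k - 1) div 2) * \<rho> ^ Suc k)
        = (r ^ k * \<rho>) * (r ^ (k * (k - 1) div 2) * \<rho> ^ k)"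
      unfolding triangle_Suc using assms by (simp add: power_add algebra_simps abs_mult)
    also have "\<dots> \<le> 1/2 * (r ^ (k * (k - 1) div 2) * \<rho> ^ k)"
      using N[OF \<open>N \<le> k\<close>] assms by (intro mult_right_mono) auto
    finally show "norm (r ^ (Suc k * (Suc k - 1) div 2) * \<rho> ^ Suc k)
        \<le> 1/2 * norm (r ^ (k * (k - 1) div 2) * \<rho> ^ k)"
      using assms by simp
  qed simp
qed

text \<open>Every term with \<open>k > 0\<close> carries at least one factor \<open>r ^ n\<close>,
  so the series without its leading 1 is at most a constant times \<open>r ^ n\<close>.\<close>

lemma suminf_tendsto_one:
  fixes f :: "nat \<Rightarrow> nat \<Rightarrow> complex" and r \<rho> M :: real
  assumes r: "0 < r" "r < 1" and nonneg: "0 \<le> \<rho>" "0 \<le> M"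
    and f0: "\<And>n. f n 0 = 1"
    and f: "\<And>n k. norm (f n k) \<le> M * r ^ (k * (k - 1) div 2) * (\<rho> * r ^ n) ^ k"
  shows "summable (f n)" and "(\<lambda>n. suminf (f n)) \<longlonglongrightarrow> 1"
proof -
  define g where "g = (\<lambda>k. M * (r ^ (k * (k - 1) div 2) * \<rho> ^ k))"
  have g: "summable g"
    unfolding g_def using r nonneg by (intro summable_mult summable_power_triangle)
  have g0: "0 \<le> g k" for k
    using r nonneg by (simp add: g_def)
  have fg: "norm (f n k) \<le> g k * (r ^ n) ^ k" for n k
    using f[of n k] by (simp add: g_def power_mult_distrib mult_ac)
  have summ: "summable (f n)" for n
  proof (rule summable_comparison_test[OF _ g], intro exI[of _ 0] allI impI)
    fix k
    have "(r ^ n) ^ k \<le> 1"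
      using r by (simp add: power_le_one)
    then have "g k * (r ^ n) ^ k \<le> g k"
      using g0[of k] by (rule mult_left_le)
    then show "norm (f n k) \<le> g k"
      using fg[of n k] by linarith
  qed
  then show "summable (f n)" .
  have bound: "norm (suminf (f n) - 1) \<le> suminf (\<lambda>k. g (Suc k)) * r ^ n" for n
  proof -
    have "norm (f n (Suc k)) \<le> g (Suc k) * r ^ n" for k
    proof -
      have "(r ^ n) ^ Suc k \<le> r ^ n"
        using r by (simp add: mult_left_le power_le_one)
      then have "g (Suc k) * (r ^ n) ^ Suc k \<le> g (Suc k) * r ^ n"
        using g0 by (intro mult_left_mono)
      then show ?thesis using fg[of n "Suc k"] by linarith
    qed
    moreover have "summable (\<lambda>k. g (Suc k) * r ^ n)"
      using g by (intro summable_mult2) (simp add: summable_Suc_iff)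
    ultimately have "norm (suminf (\<lambda>k. f n (Suc k))) \<le> suminf (\<lambda>k. g (Suc k) * r ^ n)"
      by (rule norm_suminf_le)
    also have "\<dots> = suminf (\<lambda>k. g (Suc k)) * r ^ n"
      using g by (intro suminf_mult2[symmetric]) (simp add: summable_Suc_iff)
    finally show ?thesis
      using suminf_split_head[OF summ[of n]] by (simp add: f0)
  qed
  have "(\<lambda>n. suminf (f n) - 1) \<longlonglongrightarrow> 0"
  proof (rule Lim_null_comparison)
    show "\<forall>\<^sub>F n in sequentially. norm (suminf (f n) - 1) \<le> suminf (\<lambda>k. g (Suc k)) * r ^ n"
      using bound by simp
    show "(\<lambda>n. suminf (\<lambda>k. g (Suc k)) * r ^ n) \<longlonglongrightarrow> 0"
      using r by (intro tendsto_mult_right_zero LIMSEQ_realpow_zero) auto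
  qed
  then show "(\<lambda>n. suminf (f n)) \<longlonglongrightarrow> 1"
    by (rule LIM_zero_cancel)
qed

text \<open>Reduces a contiguous relation to an identity of terms: \<open>\<gamma>\<close> and
  \<open>\<delta>\<close> go with a shift by one index, \<open>\<epsilon>\<close> with a shift by
  two. The conditions at indices 0 and 1 are the same pattern with terms of negative index read as
  0.\<close>

lemma suminf_three_term:
  fixes f g h :: "nat \<Rightarrow> complex"
  assumes "summable f" "summable g" "summable h"
    and f0: "f 0 = g 0" and f1: "f (Suc 0) = g (Suc 0) + \<gamma> * g 0 + \<delta> * h 0"
    and fSS: "\<And>k. f (Suc (Suc k)) =
      g (Suc (Suc k)) + \<gamma> * g (Suc k) + \<delta> * h (Suc k) + \<epsilon> * h k"
  shows "suminf f = (1 + \<gamma>) * suminf g + (\<delta> + \<epsilon>) * suminf h"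
proof -
  have shift: "(\<lambda>k. u (Suc k)) sums (suminf u - u 0)"
    "(\<lambda>k. u (Suc (Suc k))) sums (suminf u - u 0 - u (Suc 0))"
    if "summable u" for u :: "nat \<Rightarrow> complex"
    using summable_sums[OF that] sums_Suc_iff[of "\<lambda>k. u (Suc k)" "suminf u - u 0 - u (Suc 0)"]
    by (simp_all add: sums_Suc_iff)
  have "(\<lambda>k. f (Suc (Suc k))) sums ((suminf g - g 0 - g (Suc 0)) + \<gamma> * (suminf g - g 0)
      + \<delta> * (suminf h - h 0) + \<epsilon> * suminf h)"
    unfolding fSS using assms(1-3)
    by (intro sums_add sums_mult shift summable_sums)
  then have "suminf f - f 0 - f (Suc 0) = (suminf g - g 0 - g (Suc 0)) + \<gamma> * (suminf g - g 0)
      + \<delta> * (suminf h - h 0) + \<epsilon> * suminf h"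
    using shift(2)[OF assms(1)] sums_unique2 by blast
  then show ?thesis
    unfolding f0 f1 by (simp add: algebra_simps)
qed

section \<open>Bounds and limits of q-shifted factorials\<close>

lemma qpoch_0 [simp]: "qpoch q a 0 = 1"
  by (simp add: qpoch_def)

lemma qpoch_Suc: "qpoch q a (Suc k) = qpoch q a k * (1 - a * q ^ k)"
  by (simp add: qpoch_def)

lemma qpoch_Suc_shift: "qpoch q a (Suc k) = (1 - a) * qpoch q (a * q) k"
  unfolding qpoch_def by (subst prod.lessThan_Suc_shift) (simp add: mult_ac)

lemma qpoch_add: "qpoch q a (n + k) = qpoch q a n * qpoch q (a * q ^ n) k"
  by (induction k) (simp_all add: qpoch_Suc power_add mult_ac)

lemma qpoch_zero_left [simp]: "qpoch q 0 k = 1"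
  by (simp add: qpoch_def)

text \<open>Each factor is at most \<open>1 + R * norm q ^ j\<close>, and the product of these is at
  most the exponential of a geometric sum. The bound must be uniform in \<open>a\<close> because the
  parameter later moves with \<open>n\<close>.\<close>

lemma qpoch_bounded:
  fixes q :: complex
  assumes "norm q < 1" and R: "0 \<le> R"
  obtains M where "0 < M" "\<And>a k. norm a \<le> R \<Longrightarrow> norm (qpoch q a k) \<le> M"
proof
  show "0 < exp (R * (1 / (1 - norm q)))" by simp
  fix a :: complex and k :: nat
  assume a: "norm a \<le> R"
  have "norm (qpoch q a k) = (\<Prod>j<k. norm (1 - a * q ^ j))"
    by (simp add: qpoch_def prod_norm)
  also have "\<dots> \<le> (\<Prod>j<k. 1 + R * norm q ^ j)"
  proof (rule prod_mono, rule conjI)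
    fix j
    have "norm (1 - a * q ^ j) \<le> 1 + norm a * norm q ^ j"
      using norm_triangle_ineq4[of 1 "a * q ^ j"] by (simp add: norm_mult norm_power)
    also have "\<dots> \<le> 1 + R * norm q ^ j"
      using a by (simp add: mult_right_mono)
    finally show "norm (1 - a * q ^ j) \<le> 1 + R * norm q ^ j" .
  qed simp
  also have "\<dots> \<le> exp (\<Sum>j<k. R * norm q ^ j)"
    using R by (intro prod_le_exp_sum) simp
  also have "(\<Sum>j<k. R * norm q ^ j) \<le> R * (1 / (1 - norm q))"
  proof -
    have "(\<Sum>j<k. norm q ^ j) \<le> (\<Sum>j. norm q ^ j)"
      using assms by (intro sum_le_suminf summable_geometric) auto
    then show ?thesis
      using R assms by (simp add: suminf_geometric sum_distrib_left[symmetric] mult_left_mono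
          del: times_divide_eq_right)
  qed
  finally show "norm (qpoch q a k) \<le> exp (R * (1 / (1 - norm q)))" by simp
qed

text \<open>The infinite product converges absolutely by the geometric series, and such a product
  vanishes only if one of its factors does.\<close>

lemma qpoch_tendsto_nonzero:
  fixes q a :: complex
  assumes "norm q < 1" and a: "\<And>j. a * q ^ j \<noteq> 1"
  obtains l where "l \<noteq> 0" "qpoch q a \<longlonglongrightarrow> l"
proof
  have conv: "convergent_prod (\<lambda>j. 1 - a * q ^ j)"
  proof (intro abs_convergent_prod_imp_convergent_prod summable_imp_abs_convergent_prod)
    have "summable (\<lambda>j. norm a * norm q ^ j)"
      using assms by (intro summable_mult summable_geometric) simp
    then show "summable (\<lambda>i. norm (1 - a * q ^ i - 1))"
      by (simp add: norm_mult norm_power)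
  qed
  show "prodinf (\<lambda>j. 1 - a * q ^ j) \<noteq> 0"
    using a by (intro prodinf_nonzero conv) (metis eq_iff_diff_eq_0)
  show "qpoch q a \<longlonglongrightarrow> prodinf (\<lambda>j. 1 - a * q ^ j)"
    using convergent_prod_LIMSEQ[OF conv]
    unfolding LIMSEQ_lessThan_iff_atMost[symmetric] by (simp add: qpoch_def[abs_def])
qed

lemma qpoch_nonzero:
  assumes "\<And>j. a * q ^ j \<noteq> 1"
  shows "qpoch q a k \<noteq> 0"
  using assms by (auto simp: qpoch_def)

text \<open>The shifted symbol is a quotient of two symbols with the fixed parameter
  \<open>a\<close>, of lengths \<open>n + k\<close> and \<open>n\<close>. The inverse of the former
  is bounded since \<open>qpoch q a\<close> has a nonzero limit; this gives uniformity in both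
  \<open>n\<close> and \<open>k\<close>.\<close>

lemma qpoch_inverse_bounded:
  fixes q a :: complex
  assumes q: "norm q < 1" and a: "\<And>j. a * q ^ j \<noteq> 1"
  obtains M where "0 < M" "\<And>n k. norm (inverse (qpoch q (a * q ^ n) k)) \<le> M"
proof -
  obtain l where l: "l \<noteq> 0" "qpoch q a \<longlonglongrightarrow> l"
    using qpoch_tendsto_nonzero[OF q a] .
  then have "(\<lambda>n. inverse (qpoch q a n)) \<longlonglongrightarrow> inverse l"
    by (intro tendsto_inverse)
  then have "Bseq (\<lambda>n. inverse (qpoch q a n))"
    using convergent_imp_Bseq convergentI by blast
  then obtain K where K: "0 < K" "\<And>n. norm (inverse (qpoch q a n)) \<le> K"
    by (auto simp: Bseq_def)
  obtain M where M: "0 < M" "\<And>b k. norm b \<le> norm a \<Longrightarrow> norm (qpoch q b k) \<le> M"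
    using qpoch_bounded[OF q norm_ge_zero] by metis
  have "norm (inverse (qpoch q (a * q ^ n) k)) \<le> M * K" for n k
  proof -
    have "inverse (qpoch q (a * q ^ n) k) = qpoch q a n * inverse (qpoch q a (n + k))"
      using qpoch_nonzero[OF a] by (simp add: qpoch_add)
    also have "norm \<dots> \<le> M * K"
      unfolding norm_mult using M K by (intro mult_mono) auto
    finally show ?thesis .
  qed
  with M K show ?thesis by (intro that[of "M * K"]) auto
qed

lemma mult_power_neq_one:
  fixes q :: complex
  assumes "norm q < 1"
  shows "q * q ^ j \<noteq> 1"
proof
  assume "q * q ^ j = 1"
  then have "norm q ^ Suc j = 1"
    by (metis norm_one norm_power power_Suc)
  moreover have "norm q ^ Suc j < 1"
    using assms by (simp add: power_less_one_iff del: power_Suc)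
  ultimately show False by simp
qed

section \<open>Convergence of the two series and their limits along the shifted parameters\<close>

definition phi11_term :: "complex \<Rightarrow> complex \<Rightarrow> complex \<Rightarrow> nat \<Rightarrow> complex" where
  "phi11_term q a w k = qpoch q a k / qpoch q q k * (-1) ^ k * q ^ (k * (k - 1) div 2) * w ^ k"

definition phi01_term :: "complex \<Rightarrow> complex \<Rightarrow> complex \<Rightarrow> nat \<Rightarrow> complex" where
  "phi01_term q c w k = q ^ (k * (k - 1)) / (qpoch q c k * qpoch q q k) * w ^ k"

lemma phi11_eq_suminf: "phi11 q a 0 w = suminf (phi11_term q a w)"
  by (simp add: phi11_def phi11_term_def[abs_def])

lemma phi01_eq_suminf: "phi01 q c w = suminf (phi01_term q c w)"
  by (simp add: phi01_def phi01_term_def[abs_def])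

text \<open>The argument supplies the decay \<open>q ^ n\<close> per power, while the numerator
  symbol stays uniformly bounded. Summability is the case \<open>n = 0\<close> of the same
  estimate.\<close>

lemma phi11_tendsto_one:
  fixes q a w :: complex
  assumes q: "0 < norm q" "norm q < 1"
  shows "summable (phi11_term q a w)"
    and "(\<lambda>n. phi11 q (a * q ^ n) 0 (w * q ^ n)) \<longlonglongrightarrow> 1"
proof -
  obtain M where M: "0 < M" "\<And>b k. norm b \<le> norm a \<Longrightarrow> norm (qpoch q b k) \<le> M"
    using qpoch_bounded[OF q(2) norm_ge_zero] by metis
  obtain K where K: "0 < K" "\<And>n k. norm (inverse (qpoch q (q * q ^ n) k)) \<le> K"
    using qpoch_inverse_bounded[OF q(2) mult_power_neq_one[OF q(2)]] by metis
  define f where "f = (\<lambda>n. phi11_term q (a * q ^ n) (w * q ^ n))"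
  have f: "norm (f n k) \<le> (M * K) * norm q ^ (k * (k - 1) div 2) * (norm w * norm q ^ n) ^ k" for n k
  proof -
    have "norm (a * q ^ n) \<le> norm a"
      using q by (simp add: norm_mult norm_power mult_left_le power_le_one)
    then have "norm (qpoch q (a * q ^ n) k) * norm (inverse (qpoch q q k)) \<le> M * K"
      using M K(2)[of 0 k] by (intro mult_mono) auto
    then have "norm (qpoch q (a * q ^ n) k) * norm (inverse (qpoch q q k))
        * (norm q ^ (k * (k - 1) div 2) * (norm w * norm q ^ n) ^ k)
      \<le> (M * K) * (norm q ^ (k * (k - 1) div 2) * (norm w * norm q ^ n) ^ k)"
      by (intro mult_right_mono) auto
    then show ?thesis
      by (simp add: f_def phi11_term_def norm_mult norm_divide norm_power norm_inverse
          divide_inverse mult_ac)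
  qed
  have "f n 0 = 1" for n
    by (simp add: f_def phi11_term_def)
  note * = suminf_tendsto_one[of "norm q" "norm w" "M * K" f, OF q norm_ge_zero _ this f]
  show "summable (phi11_term q a w)"
    using *(1)[of 0] M K by (simp add: f_def)
  show "(\<lambda>n. phi11 q (a * q ^ n) 0 (w * q ^ n)) \<longlonglongrightarrow> 1"
    using *(2) M K by (simp add: f_def phi11_eq_suminf)
qed

lemma phi01_tendsto_one:
  fixes q c w :: complex
  assumes q: "0 < norm q" "norm q < 1" and c: "\<And>j. c * q ^ j \<noteq> 1"
  shows "summable (phi01_term q c w)"
    and "(\<lambda>n. phi01 q (c * q ^ n) (w * q ^ (2 * n))) \<longlonglongrightarrow> 1"
proof -
  obtain M where M: "0 < M" "\<And>n k. norm (inverse (qpoch q (c * q ^ n) k)) \<le> M"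
    using qpoch_inverse_bounded[OF q(2) c] by metis
  obtain K where K: "0 < K" "\<And>n k. norm (inverse (qpoch q (q * q ^ n) k)) \<le> K"
    using qpoch_inverse_bounded[OF q(2) mult_power_neq_one[OF q(2)]] by metis
  define f where "f = (\<lambda>n. phi01_term q (c * q ^ n) (w * q ^ (2 * n)))"
  have f: "norm (f n k) \<le> (M * K) * norm q ^ (k * (k - 1) div 2) * (norm w * norm q ^ n) ^ k" for n k
  proof -
    have "norm (inverse (qpoch q (c * q ^ n) k)) * norm (inverse (qpoch q q k)) \<le> M * K"
      using M K(2)[of 0 k] by (intro mult_mono) auto
    \<comment> \<open>Half of the quadratic exponent, and below one of the two factors
      \<open>q ^ n\<close>, is given away to fit the common bound of
      \<open>suminf_tendsto_one\<close>.\<close>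
    moreover have "norm q ^ (k * (k - 1)) \<le> norm q ^ (k * (k - 1) div 2)"
      using q by (intro power_decreasing) auto
    moreover have "(norm w * norm q ^ (2 * n)) ^ k \<le> (norm w * norm q ^ n) ^ k"
      using q by (intro power_mono mult_left_mono power_decreasing) auto
    ultimately have "norm (inverse (qpoch q (c * q ^ n) k)) * norm (inverse (qpoch q q k))
        * norm q ^ (k * (k - 1)) * (norm w * norm q ^ (2 * n)) ^ k
      \<le> (M * K) * norm q ^ (k * (k - 1) div 2) * (norm w * norm q ^ n) ^ k"
      using M K by (intro mult_mono[OF mult_mono]) auto
    then show ?thesis
      by (simp add: f_def phi01_term_def norm_mult norm_divide norm_power norm_inverse
          divide_inverse mult_ac)
  qed
  have "f n 0 = 1" for n
    by (simp add: f_def phi01_term_def)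
  note * = suminf_tendsto_one[of "norm q" "norm w" "M * K" f, OF q norm_ge_zero _ this f]
  show "summable (phi01_term q c w)"
    using *(1)[of 0] M K by (simp add: f_def)
  show "(\<lambda>n. phi01 q (c * q ^ n) (w * q ^ (2 * n))) \<longlonglongrightarrow> 1"
    using *(2) M K by (simp add: f_def phi01_eq_suminf)
qed

section \<open>Contiguous relations, both proved by comparing terms\<close>

text \<open>With \<open>B = A * q ^ n\<close> and \<open>w = v * q ^ n\<close> the coefficients are
  those of the continued fraction divided by \<open>z\<close> and \<open>z^2\<close>. Comparing
  powers of \<open>w\<close> puts the first coefficient at shift one and the last at shift
  two.\<close>

lemma phi11_contiguous:
  fixes q B w :: complex
  assumes q: "0 < norm q" "norm q < 1"
  shows "phi11 q (B / q) 0 w = (1 - w + (1 + q) * B * w / q) * phi11 q B 0 (w * q)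
    + w^2 * q * B * (1 - B) * phi11 q (B * q) 0 (w * q^2)"
proof -
  have q0: "q \<noteq> 0" using q by auto
  have E: "1 - q * q ^ j \<noteq> 0" for j
    using mult_power_neq_one[OF q(2), of j] by simp
  have Q: "qpoch q q k \<noteq> 0" for k
    using mult_power_neq_one[OF q(2)] by (rule qpoch_nonzero)
  have E1: "1 - q \<noteq> 0" using E[of 0] by simp
  \<comment> \<open>All numerator symbols are reduced to \<open>qpoch q B (Suc k)\<close>. The
    factor \<open>1 - B\<close> stays on the left, so nothing is divided by a quantity that may
    vanish.\<close>
  have B: "qpoch q (B / q) (Suc k) = (1 - B / q) * qpoch q B k"
    "(1 - B) * qpoch q (B * q) k = qpoch q B (Suc k)" for k
    using q0 by (simp_all add: qpoch_Suc_shift)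
  have "suminf (phi11_term q (B / q) w) =
      (1 + (- w + (1 + q) * B * w / q)) * suminf (phi11_term q B (w * q))
      + (0 + w^2 * q * B * (1 - B)) * suminf (phi11_term q (B * q) (w * q^2))"
  proof (rule suminf_three_term)
    show "phi11_term q (B / q) w (Suc 0) = phi11_term q B (w * q) (Suc 0)
        + (- w + (1 + q) * B * w / q) * phi11_term q B (w * q) 0 + 0 * phi11_term q (B * q) (w * q^2) 0"
      using q0 E1 by (simp add: phi11_term_def qpoch_Suc divide_simps) (simp add: algebra_simps)
    fix k
    define x where "x = q ^ k"
    define t where "t = (-1) ^ k * q ^ (k * (k - 1) div 2) * w ^ k / qpoch q q k"
    have x0: "x \<noteq> 0" using q0 by (simp add: x_def)
    have Ex: "1 - q * x \<noteq> 0" "1 - q * (q * x) \<noteq> 0"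
      using E[of k] E[of "Suc k"] by (simp_all add: x_def)
    have 1: "phi11_term q (B / q) w (Suc (Suc k)) =
        (1 - B / q) * qpoch q B (Suc k) * t * (q * x^2 * w^2 / ((1 - q * x) * (1 - q * (q * x))))"
      unfolding phi11_term_def B(1) triangle_Suc qpoch_Suc[of q q]
      by (simp add: t_def x_def power_add power2_eq_square mult_ac divide_inverse)
    have 2: "phi11_term q B (w * q) (Suc (Suc k)) =
        qpoch q B (Suc k) * (1 - B * (q * x)) * t
        * (q * x^2 * w^2 / ((1 - q * x) * (1 - q * (q * x)))) * (q^2 * x)"
      unfolding phi11_term_def triangle_Suc qpoch_Suc[of q q] qpoch_Suc[of q B "Suc k"]
      by (simp add: t_def x_def power_add power_mult_distrib power2_eq_square mult_ac divide_inverse)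
    have 3: "phi11_term q B (w * q) (Suc k) =
        - (qpoch q B (Suc k) * t * (x * w / (1 - q * x)) * (q * x))"
      unfolding phi11_term_def triangle_Suc qpoch_Suc[of q q]
      by (simp add: t_def x_def power_add power_mult_distrib power2_eq_square mult_ac divide_inverse)
    have 4: "(1 - B) * phi11_term q (B * q) (w * q^2) k = qpoch q B (Suc k) * t * x^2"
      unfolding B(2)[symmetric] phi11_term_def
      by (simp add: t_def x_def power_mult_distrib power2_eq_square mult_ac divide_inverse)
    \<comment> \<open>What remains after removing the common factor
      \<open>qpoch q B (Suc k) * t\<close> is a rational identity in \<open>x\<close>, which stands
      for \<open>q ^ k\<close>.\<close>
    have *: "(1 - B / q) * (q * x^2 * w^2 / ((1 - q * x) * (1 - q * (q * x))))
      = (1 - B * (q * x)) * (q * x^2 * w^2 / ((1 - q * x) * (1 - q * (q * x)))) * (q^2 * x)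
        - (- w + (1 + q) * B * w / q) * (x * w / (1 - q * x)) * (q * x)
        + w^2 * q * B * x^2"
      using q0 Ex by (simp add: divide_simps) algebra
    show "phi11_term q (B / q) w (Suc (Suc k)) = phi11_term q B (w * q) (Suc (Suc k))
        + (- w + (1 + q) * B * w / q) * phi11_term q B (w * q) (Suc k)
        + 0 * phi11_term q (B * q) (w * q^2) (Suc k)
        + w^2 * q * B * (1 - B) * phi11_term q (B * q) (w * q^2) k"
    proof -
      have "phi11_term q (B / q) w (Suc (Suc k)) = qpoch q B (Suc k) * t *
        ((1 - B / q) * (q * x^2 * w^2 / ((1 - q * x) * (1 - q * (q * x)))))"
        unfolding 1 by (simp only: mult_ac)
      also have "\<dots> = phi11_term q B (w * q) (Suc (Suc k))
        + (- w + (1 + q) * B * w / q) * phi11_term q B (w * q) (Suc k)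
        + w^2 * q * B * ((1 - B) * phi11_term q (B * q) (w * q^2) k)"
        unfolding * 2 3 4 by (simp only: ring_distribs mult_ac mult_minus_left mult_minus_right diff_conv_add_uminus)
      finally show ?thesis by (simp only: mult_ac mult_zero_left add_0_right)
    qed
  qed (use q in \<open>auto intro: phi11_tendsto_one simp: phi11_term_def\<close>)
  then show ?thesis
    by (simp add: phi11_eq_suminf)
qed

text \<open>This is the recurrence of \<open>phi11_contiguous\<close> up to the denominators
  \<open>1 - v\<close> and \<open>(1 - v) * (1 - v * q)\<close>, which a later normalization
  absorbs.\<close>

lemma phi01_contiguous:
  fixes q B v :: complex
  assumes q: "0 < norm q" "norm q < 1" and v: "\<And>j. v * q ^ j \<noteq> 1"
  shows "phi01 q v (B * v / q) = (1 + (1 + q) * B * v / (q * (1 - v))) * phi01 q (v * q) (B * v * q)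
    + v^2 * q * B * (1 - B) / ((1 - v) * (1 - v * q)) * phi01 q (v * q^2) (B * v * q^3)"
proof -
  have q0: "q \<noteq> 0" using q by auto
  have E: "1 - q * q ^ j \<noteq> 0" for j
    using mult_power_neq_one[OF q(2), of j] by simp
  have E1: "1 - q \<noteq> 0" using E[of 0] by simp
  have V: "1 - v * q ^ j \<noteq> 0" for j
    using v[of j] by simp
  have V12: "1 - v \<noteq> 0" "1 - v * q \<noteq> 0"
    using V[of 0] V[of 1] by simp_all
  have v': "v * q * q ^ j \<noteq> 1" "v * q^2 * q ^ j \<noteq> 1" for j
    using v[of "Suc j"] v[of "Suc (Suc j)"] by (simp_all add: power2_eq_square mult_ac)
  have vq: "inverse (qpoch q (v * q) k) = (1 - v) * inverse (qpoch q v (Suc k))" for k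
    using V12 by (simp add: qpoch_Suc_shift)
  have vq2: "inverse (qpoch q (v * q^2) k) = (1 - v) * (1 - v * q) * inverse (qpoch q v (Suc (Suc k)))" for k
    using V12 by (simp add: qpoch_Suc_shift power2_eq_square mult_ac)
  define y where "y = B * v / q"
  \<comment> \<open>The last coefficient splits by degree in \<open>y\<close> for fixed
    \<open>v\<close>: \<open>\<delta>\<close> is linear and shifts one index, whereas
    \<open>\<epsilon>\<close> is quadratic because \<open>B * v = q * y\<close>, and shifts
    two.\<close>
  define \<gamma> \<delta> \<epsilon> where "\<gamma> = (1 + q) * y / (1 - v)"
    and "\<delta> = v * q^2 * y / ((1 - v) * (1 - v * q))" and "\<epsilon> = - (B * \<delta>)"
  have y1: "B * v * q = y * q^2" "B * v * q^3 = y * q^4"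
    using q0 by (simp_all add: y_def power2_eq_square power3_eq_cube power4_eq_xxxx)
  have "suminf (phi01_term q v y) =
      (1 + \<gamma>) * suminf (phi01_term q (v * q) (y * q^2))
      + (\<delta> + \<epsilon>) * suminf (phi01_term q (v * q^2) (y * q^4))"
  proof (rule suminf_three_term)
    show "phi01_term q v y (Suc 0) = phi01_term q (v * q) (y * q^2) (Suc 0)
        + \<gamma> * phi01_term q (v * q) (y * q^2) 0 + \<delta> * phi01_term q (v * q^2) (y * q^4) 0"
      using E1 V12 by (simp add: phi01_term_def qpoch_Suc \<gamma>_def \<delta>_def divide_simps) algebra
    fix k
    define x where "x = q ^ k"
    define t where "t = q ^ (k * (k - 1)) * y ^ k / (qpoch q q k * qpoch q v (Suc (Suc k)))"
    have P: "q ^ (Suc k * (Suc k - 1)) = q ^ (k * (k - 1)) * x^2"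
      "q ^ (Suc (Suc k) * (Suc (Suc k) - 1)) = q ^ (k * (k - 1)) * x^4 * q^2"
      by (cases k; simp add: x_def power_add power_mult power2_eq_square power4_eq_xxxx mult_ac
          flip: power_mult_distrib)+
    have X: "(y * q^2) ^ k = y ^ k * x^2" "(y * q^4) ^ k = y ^ k * x^4"
      by (simp_all add: x_def power_mult_distrib power_mult[symmetric] mult.commute)
    \<comment> \<open>\<open>L\<close> is the factor by which the symbols of length
      \<open>k + 3\<close> exceed the common denominator \<open>qpoch q v (Suc (Suc k))\<close>. It
      stays opaque while fractions are cleared.\<close>
    define L where "L = 1 - v * q^2 * x"
    have Ex: "1 - q * x \<noteq> 0" "1 - q * (q * x) \<noteq> 0" and L0: "L \<noteq> 0"
      using E[of k] E[of "Suc k"] V[of "Suc (Suc k)"]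
      by (simp_all add: x_def L_def power2_eq_square mult_ac)
    have vL: "qpoch q v (Suc (Suc (Suc k))) = qpoch q v (Suc (Suc k)) * L"
      by (simp add: qpoch_Suc[of q v "Suc (Suc k)"] L_def x_def power2_eq_square mult_ac)
    have qq: "qpoch q q (Suc k) = qpoch q q k * (1 - q * x)"
      "qpoch q q (Suc (Suc k)) = qpoch q q k * (1 - q * x) * (1 - q * (q * x))"
      by (simp_all add: qpoch_Suc x_def)
    note terms = phi01_term_def divide_inverse inverse_mult_distrib vq vq2 vL P qq X power_Suc
    have 1: "phi01_term q v y (Suc (Suc k)) =
        t * (x^4 * q^2 * y^2 / ((1 - q * x) * (1 - q * (q * x))))"
      unfolding terms t_def power2_eq_square by (simp only: mult_ac)
    have 2: "phi01_term q (v * q) (y * q^2) (Suc (Suc k)) =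
        t * (x^4 * q^2 * (y * q^2)^2 * x^2 * (1 - v) / (L * ((1 - q * x) * (1 - q * (q * x)))))"
      unfolding terms t_def power2_eq_square[of "y * q^2"] by (simp only: mult_ac)
    have 3: "phi01_term q (v * q) (y * q^2) (Suc k) = t * (x^4 * (y * q^2) * (1 - v) / (1 - q * x))"
      unfolding terms t_def by (simp add: power2_eq_square power4_eq_xxxx mult_ac)
    have 4: "phi01_term q (v * q^2) (y * q^4) (Suc k)
      = t * (x^6 * (y * q^4) * (1 - v) * (1 - v * q) / (L * (1 - q * x)))"
      unfolding terms t_def by (simp add: eval_nat_numeral mult_ac)
    have 5: "phi01_term q (v * q^2) (y * q^4) k = t * (x^4 * (1 - v) * (1 - v * q))"
      unfolding terms t_def by (simp only: mult_ac)
    have \<gamma>': "\<gamma> * (1 - v) = (1 + q) * y"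
      and \<delta>': "\<delta> * ((1 - v) * (1 - v * q)) = v * q^2 * y"
      and \<epsilon>': "\<epsilon> * ((1 - v) * (1 - v * q)) = - (q^3 * y^2)"
      using V12 q0 unfolding \<gamma>_def \<delta>_def \<epsilon>_def y_def
      by (simp_all add: power2_eq_square power3_eq_cube)
    have *: "x^4 * q^2 * y^2 / ((1 - q * x) * (1 - q * (q * x))) =
        x^4 * q^2 * (y * q^2)^2 * x^2 * (1 - v) / (L * ((1 - q * x) * (1 - q * (q * x))))
        + (1 + q) * y * (x^4 * (y * q^2) / (1 - q * x))
        + v * q^2 * y * (x^6 * (y * q^4) / (L * (1 - q * x)))
        - q^3 * y^2 * x^4"
      using Ex L0 by (simp add: divide_simps) (simp add: L_def, algebra)
    show "phi01_term q v y (Suc (Suc k)) = phi01_term q (v * q) (y * q^2) (Suc (Suc k))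
        + \<gamma> * phi01_term q (v * q) (y * q^2) (Suc k)
        + \<delta> * phi01_term q (v * q^2) (y * q^4) (Suc k)
        + \<epsilon> * phi01_term q (v * q^2) (y * q^4) k"
    proof -
      have "\<gamma> * phi01_term q (v * q) (y * q^2) (Suc k)
          = t * ((\<gamma> * (1 - v)) * (x^4 * (y * q^2) / (1 - q * x)))"
        unfolding 3 by simp
      moreover have "\<delta> * phi01_term q (v * q^2) (y * q^4) (Suc k)
          = t * ((\<delta> * ((1 - v) * (1 - v * q))) * (x^6 * (y * q^4) / (L * (1 - q * x))))"
        unfolding 4 by simp
      moreover have "\<epsilon> * phi01_term q (v * q^2) (y * q^4) k
          = t * ((\<epsilon> * ((1 - v) * (1 - v * q))) * x^4)"
        unfolding 5 by simp
      ultimately show ?thesis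
        unfolding \<gamma>' \<delta>' \<epsilon>' 1 2 * by (simp only: ring_distribs) simp
    qed
  qed (use phi01_tendsto_one(1)[OF q v] phi01_tendsto_one(1)[OF q v'(1)]
      phi01_tendsto_one(1)[OF q v'(2)] in \<open>auto simp: phi01_term_def\<close>)
  moreover have "1 + \<gamma> = 1 + (1 + q) * B * v / (q * (1 - v))"
    by (simp add: \<gamma>_def y_def)
  moreover have "\<delta> + \<epsilon> = v^2 * q * B * (1 - B) / ((1 - v) * (1 - v * q))"
  proof -
    have *: "\<delta> = v^2 * q * B / ((1 - v) * (1 - v * q))"
      using q0 by (simp add: \<delta>_def y_def power2_eq_square)
    have "\<delta> + \<epsilon> = (1 - B) * \<delta>"
      by (simp add: \<epsilon>_def algebra_simps)
    then show ?thesis unfolding * by (simp add: mult_ac)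
  qed
  ultimately show ?thesis
    unfolding phi01_eq_suminf y1 y_def[symmetric] by simp
qed

section \<open>The continued fraction and its two values\<close>

lemma lower_ok_iff:
  assumes "q \<noteq> 0"
  shows "lower_ok q c \<longleftrightarrow> (\<forall>j. c * q ^ j \<noteq> 1)"
  using assms by (simp add: lower_ok_def power_int_minus field_simps)

theorem mainTheorem9:
  fixes q A z :: complex
  assumes "0 < norm q" and "norm q < 1"
    and "A \<noteq> 0" and "\<forall>k::nat. A \<noteq> q powi (- int k)"
    and "z \<noteq> 0"
    and "lower_ok q (q / (A * z))" and "lower_ok q (1 / (A * z))"
    and "(1 - 1 / (A * z)) * phi01 q (1 / (A * z)) (1 / (q * z)) \<noteq> 0"
    and "phi11 q (A / q) 0 (1 / (A * z)) \<noteq> 0"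
  shows "jfrac_has_value (wall_a q A) (wall_bsq q A) z
           (1 / z * (phi01 q (q / (A * z)) (q / z)
              / ((1 - 1 / (A * z)) * phi01 q (1 / (A * z)) (1 / (q * z)))))
       \<and> 1 / z * (phi01 q (q / (A * z)) (q / z)
              / ((1 - 1 / (A * z)) * phi01 q (1 / (A * z)) (1 / (q * z))))
         = 1 / z * (phi11 q A 0 (q / (A * z)) / phi11 q (A / q) 0 (1 / (A * z)))"
proof -
  let ?a = "wall_a q A" and ?b = "wall_bsq q A"
  define v where "v = 1 / (A * z)"
  define c where "c = (\<lambda>n. if n = 0 then 1 else - ?b n)"
  define d where "d = (\<lambda>n. z - ?a n)"
  note q = assms(1,2)
  have q0: "q \<noteq> 0" using q by auto
  have v: "v * q ^ j \<noteq> 1" for j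
    using assms(7) unfolding lower_ok_iff[OF q0] v_def by blast

  have powi: "q powi (2 * int n - 1) = q ^ (2 * n) / q" "q powi (3 * int (Suc n) - 2) = q ^ (3 * n + 1)"
    "q powi (int (Suc n) - 1) = q ^ n" for n
  proof -
    show "q powi (2 * int n - 1) = q ^ (2 * n) / q"
      using q0 by (simp add: power_int_diff flip: power_int_of_nat)
    have "3 * int (Suc n) - 2 = int (3 * n + 1)" by simp
    then show "q powi (3 * int (Suc n) - 2) = q ^ (3 * n + 1)"
      by (metis power_int_of_nat)
    have "int (Suc n) - 1 = int n" by simp
    then show "q powi (int (Suc n) - 1) = q ^ n"
      by (metis power_int_of_nat)
  qed
  have dz: "d n / z = 1 - v * q ^ n + (1 + q) * (A * q ^ n) * (v * q ^ n) / q" for n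
    unfolding d_def wall_a_def powi v_def using assms(3,5) q0
    by (simp add: field_simps power2_eq_square power_mult)
  have cz: "c (Suc n) / z^2 = (v * q ^ n)^2 * q * (A * q ^ n) * (1 - A * q ^ n)" for n
    unfolding c_def wall_bsq_def powi v_def using assms(3,5)
    by (simp add: field_simps power2_eq_square power_add power_mult power3_eq_cube)

  define Q where "Q = (\<lambda>n. phi11 q (A / q * q ^ n) 0 (v * q ^ n))"
  \<comment> \<open>Dividing by \<open>qpoch q v n\<close> cancels the denominators in
    \<open>phi01_contiguous\<close>, so \<open>U\<close> obeys the same recurrence as
    \<open>Q\<close>.\<close>
  define U where "U = (\<lambda>n. phi01 q (v * q ^ n) (A * v / q * q ^ (2 * n)) / qpoch q v n)"
  have Q_rec: "Q n = d n / z * Q (Suc n) + c (Suc n) / z^2 * Q (Suc (Suc n))" for n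
    using phi11_contiguous[OF q, of "A * q ^ n" "v * q ^ n"] q0
    unfolding dz cz by (simp add: Q_def power2_eq_square mult_ac)
  have U_rec: "U n = d n / z * U (Suc n) + c (Suc n) / z^2 * U (Suc (Suc n))" for n
  proof -
    define w B P where "w = v * q ^ n" and "B = A * q ^ n" and "P = qpoch q v n"
    have w: "w * q ^ j \<noteq> 1" for j
      using v[of "n + j"] by (simp add: w_def power_add mult_ac)
    have w12: "1 - w \<noteq> 0" "1 - w * q \<noteq> 0"
      using w[of 0] w[of 1] by simp_all
    have P0: "P \<noteq> 0"
      unfolding P_def using v by (rule qpoch_nonzero)
    have U: "U n = phi01 q w (B * w / q) / P"
      "U (Suc n) = phi01 q (w * q) (B * w * q) / (P * (1 - w))"
      "U (Suc (Suc n)) = phi01 q (w * q^2) (B * w * q^3) / (P * (1 - w) * (1 - w * q))"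
      using q0 by (simp_all add: U_def w_def B_def P_def qpoch_Suc power2_eq_square power3_eq_cube
          mult_2_right power_add mult_ac)
    show ?thesis
      unfolding dz cz U phi01_contiguous[OF q w, of B] w_def[symmetric] B_def[symmetric]
      using P0 w12 q0 by (simp add: divide_simps)
  qed

  have Q_lim: "Q \<longlonglongrightarrow> 1"
    unfolding Q_def by (rule phi11_tendsto_one(2)[OF q])
  obtain l where l: "l \<noteq> 0" "qpoch q v \<longlonglongrightarrow> l"
    using qpoch_tendsto_nonzero[OF q(2) v] by metis
  have U_lim: "U \<longlonglongrightarrow> 1 / l"
    unfolding U_def by (intro tendsto_divide phi01_tendsto_one(2) q v l)

  \<comment> \<open>The first two summands bound \<open>d n / z - 1\<close>, the third bounds
    \<open>c (Suc n) / z^2\<close>, each up to \<open>norm q ^ n\<close>. Division by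
    \<open>norm q\<close> in \<open>e\<close> makes \<open>e (Suc n)\<close> equal to
    \<open>K * norm q ^ n\<close>, as the index shift for \<open>c\<close> demands.\<close>
  define K where "K = norm v + norm ((1 + q) * A * v / q) + norm (v^2 * q * A) * (1 + norm A)"
  define e where "e = (\<lambda>n. (K / norm q) * norm q ^ n)"
  have e: "summable e"
    unfolding e_def using q by (intro summable_mult summable_geometric) simp
  have le: "K * norm q ^ n \<le> e n" for n
  proof -
    have "0 \<le> K" by (simp add: K_def)
    then have "K \<le> K / norm q"
      using q by (simp add: field_simps mult_left_le)
    then show ?thesis
      unfolding e_def by (intro mult_right_mono) auto
  qed
  have e_d: "norm (d n / z - 1) \<le> e n" for n
  proof -
    have "d n / z - 1 = q ^ n * ((1 + q) * A * v / q * q ^ n - v)"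
      by (simp add: dz algebra_simps)
    also have "norm \<dots> \<le> norm q ^ n * (norm ((1 + q) * A * v / q) + norm v)"
    proof -
      have "norm ((1 + q) * A * v / q * q ^ n) \<le> norm ((1 + q) * A * v / q)"
        unfolding norm_mult[of _ "q ^ n"] using q by (intro mult_left_le) (auto simp: norm_power power_le_one)
      then have "norm ((1 + q) * A * v / q * q ^ n - v) \<le> norm ((1 + q) * A * v / q) + norm v"
        by (meson add_right_mono norm_triangle_ineq4 order_trans)
      then show ?thesis
        unfolding norm_mult[of "q ^ n"] norm_power by (intro mult_left_mono) auto
    qed
    also have "\<dots> \<le> K * norm q ^ n"
      unfolding K_def by (subst mult.commute) (intro mult_right_mono, auto)
    finally show ?thesis using le[of n] by linarith
  qed
  have e_c: "norm (c (Suc n) / z^2) \<le> e (Suc n)" for n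
  proof -
    have "c (Suc n) / z^2 = q ^ n * ((v^2 * q * A) * (1 - A * q ^ n) * q ^ (2 * n))"
      unfolding cz by (simp add: power2_eq_square mult_2_right power_add mult_ac)
    also have "norm \<dots> \<le> norm q ^ n * (norm (v^2 * q * A) * (1 + norm A) * 1)"
    proof -
      have "norm (A * q ^ n) \<le> norm A"
        using q by (simp add: norm_mult norm_power mult_left_le power_le_one)
      then have "norm (1 - A * q ^ n) \<le> 1 + norm A"
        using norm_triangle_ineq4[of 1 "A * q ^ n"] by simp
      then show ?thesis
        unfolding norm_mult[of "q ^ n"] norm_mult[of _ "q ^ (2 * n)"] norm_mult[of _ "1 - A * q ^ n"]
          norm_power[of q] using q
        by (intro mult_left_mono mult_mono power_le_one mult_nonneg_nonneg zero_le_power norm_ge_zero order_refl)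
          auto
    qed
    also have "\<dots> \<le> K * norm q ^ n"
      unfolding K_def by (subst mult.commute) (intro mult_right_mono, auto)
    also have "\<dots> = e (Suc n)"
      using q by (simp add: e_def)
    finally show ?thesis .
  qed

  define c' d' where "c' = (\<lambda>n. c (Suc n))" and "d' = (\<lambda>n. d (Suc n))"
  have den: "(\<lambda>n. cf_den c d n / z ^ n * x) \<longlonglongrightarrow> X 0"
    and den': "(\<lambda>n. cf_den c' d' n / z ^ n * x) \<longlonglongrightarrow> X (Suc 0)"
    if X: "\<And>n. X n = d n / z * X (Suc n) + c (Suc n) / z^2 * X (Suc (Suc n))" "X \<longlonglongrightarrow> x"
    for X x
  proof -
    show "(\<lambda>n. cf_den c d n / z ^ n * x) \<longlonglongrightarrow> X 0"
      by (rule cf_den_tendsto[OF assms(5) X e e_d e_c])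
    show "(\<lambda>n. cf_den c' d' n / z ^ n * x) \<longlonglongrightarrow> X (Suc 0)"
      unfolding c'_def d'_def
      by (rule cf_den_tendsto[where X = "\<lambda>n. X (Suc n)" and e = "\<lambda>n. e (Suc n)",
            OF assms(5) X(1) LIMSEQ_Suc[OF X(2)] _ e_d e_c]) (simp add: summable_Suc_iff e)
  qed
  have den_Q: "(\<lambda>n. cf_den c d n / z ^ n) \<longlonglongrightarrow> Q 0" "(\<lambda>n. cf_den c' d' n / z ^ n) \<longlonglongrightarrow> Q 1"
    using den[OF Q_rec Q_lim] den'[OF Q_rec Q_lim] by simp_all
  \<comment> \<open>Both solutions are tested against the same denominators; uniqueness of limits
    makes \<open>U\<close> proportional to \<open>Q\<close> at the first two indices.\<close>
  have QU: "Q 0 * (1 / l) = U 0" "Q 1 * (1 / l) = U 1"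
    using LIMSEQ_unique[OF tendsto_mult_right[OF den_Q(1)] den[OF U_rec U_lim]]
      LIMSEQ_unique[OF tendsto_mult_right[OF den_Q(2)] den'[OF U_rec U_lim]] by simp_all
  have Q_phi: "Q 0 = phi11 q (A / q) 0 (1 / (A * z))" "Q 1 = phi11 q A 0 (q / (A * z))"
    using q0 by (simp_all add: Q_def v_def)
  have U_phi: "U 0 = phi01 q (1 / (A * z)) (1 / (q * z))"
    "U 1 = phi01 q (q / (A * z)) (q / z) / (1 - 1 / (A * z))"
    using q0 assms(3) by (simp_all add: U_def v_def qpoch_Suc power2_eq_square mult.commute)
  have ratio: "phi01 q (q / (A * z)) (q / z) / ((1 - 1 / (A * z)) * phi01 q (1 / (A * z)) (1 / (q * z)))
      = Q 1 / Q 0"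
  proof -
    have "phi01 q (q / (A * z)) (q / z) / ((1 - 1 / (A * z)) * phi01 q (1 / (A * z)) (1 / (q * z)))
        = U 1 / U 0"
      unfolding U_phi by simp
    also have "\<dots> = Q 1 / Q 0"
      unfolding QU[symmetric] using l(1) by simp
    finally show ?thesis .
  qed
  have Q0: "Q 0 \<noteq> 0"
    using assms(9) by (simp add: Q_phi)

  have "cf_has_value c d (1 / z * (Q 1 / Q 0))"
    unfolding cf_has_value_def
  proof
    have "\<forall>\<^sub>F n in sequentially. cf_den c d n / z ^ n \<noteq> 0"
      using tendsto_imp_eventually_ne[OF den_Q(1) Q0] .
    then show "\<forall>\<^sub>F n in sequentially. cf_den c d n \<noteq> 0"
      by eventually_elim auto
    \<comment> \<open>Since \<open>c 0 = 1\<close>, the numerators are the denominators of the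
      shifted fraction one level lower; the missing power of \<open>z\<close> is the prefactor
      \<open>1 / z\<close>.\<close>
    have "cf_num c d (Suc n) = cf_den c' d' n" for n
      by (simp add: cf_num_shift c'_def d'_def c_def)
    then have "cf_num c d (Suc n) / cf_den c d (Suc n)
        = 1 / z * ((cf_den c' d' n / z ^ n) / (cf_den c d (Suc n) / z ^ Suc n))" for n
      using assms(5) by simp
    moreover have "(\<lambda>n. 1 / z * ((cf_den c' d' n / z ^ n) / (cf_den c d (Suc n) / z ^ Suc n)))
        \<longlonglongrightarrow> 1 / z * (Q 1 / Q 0)"
      by (intro tendsto_mult tendsto_divide tendsto_const den_Q LIMSEQ_Suc[OF den_Q(1)] Q0)
    ultimately have "(\<lambda>n. cf_num c d (Suc n) / cf_den c d (Suc n)) \<longlonglongrightarrow> 1 / z * (Q 1 / Q 0)"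
      by simp
    then show "(\<lambda>n. cf_num c d n / cf_den c d n) \<longlonglongrightarrow> 1 / z * (Q 1 / Q 0)"
      by (rule LIMSEQ_imp_Suc)
  qed
  then show ?thesis
    unfolding ratio jfrac_has_value_def Q_phi[symmetric] c_def d_def by simp
qed

end
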